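(* Let $f\in\mathcal S'(\mathbb R^d)$ be compactly supported, let $L$ be the order of the Strang--Fix conditions for $f$, let $\mathcal V_{\mathrm{sh}}$ be the largest shift-invariant subspace of $$\mathcal V=\left\{P\in\Pi:\ \left(P(-iD)\hat f\right)(2\pi k)=0\ \text{ for all } k\in\mathbb Z^d\setminus\{0\}\right\},$$ and let $$\tilde{\mathcal V}=\left\{\sum_{k=1}^{\overline d(L)} v_k\,x^{\alpha^{(k)}}:\ v\in V\right\},\qquad V=\ker\overline{\boldsymbol\Delta}_L\hat f .$$ Then $\tilde{\mathcal V}=\mathcal V_{\mathrm{sh}}$.
   Context: $\Pi$ is the space of all polynomials on $\mathbb R^d$ (polynomial spaces are considered over $\mathbb R$). $\hat f(\xi)=(2\pi)^{-d/2}\int f(x)e^{-i\xi\cdot x}\,dx$ is the Fourier transform, extended to compactly supported tempered distributions. $P(-iD)$ is the constant-coefficient differential operator obtained by substituting $-iD_n$ ($D_n$ the $n$th partial derivative) for the $n$th variable of $P$. A space of polynomials is shift-invariant if it contains $P(\cdot+h)$ for every $P$ in it and every $h\in\mathbb R^d$. For $l\in\mathbb Z_{\ge0}$ let $\overline d(l)=\frac{(d+l)!}{l!\,d!}$ and let $\alpha^{(1)},\dots,\alpha^{(\overline d(l))}$ be the multi-indices in $\mathbb Z^d_{\ge0}$ of length $\le l$, listed in graded lexicographical order (first by length, then lexicographically). For $\xi\in\mathbb R^d$, $\overline{\boldsymbol D}_l\hat f(\xi)$ is the $\overline d(l)\times\overline d(l)$ matrix whose $(j,k)$ entry is $\binom{\alpha^{(k)}}{\alpha^{(j)}}(-i)^{|\alpha^{(k)}|-|\alpha^{(j)}|}\left(D^{\alpha^{(k)}-\alpha^{(j)}}\hat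 f\right)(\xi)$ if $\alpha^{(j)}\le\alpha^{(k)}$ componentwise, and $0$ otherwise. $\overline{\boldsymbol\Delta}_l\hat f$ is the matrix with infinitely many rows obtained by stacking the matrices $\overline{\boldsymbol D}_l\hat f(2\pi n)$ over all $n\in\mathbb Z^d\setminus\{0\}$ (in any order). For a matrix $M$ with $m$ columns, $\ker M=\{v\in\mathbb R^m: Mv=0\}$. The order of the Strang--Fix conditions for $f$ is the minimal $l\in\mathbb Z_{\ge0}$ for which $\dim\ker\overline{\boldsymbol\Delta}_l\hat f=\max\{\dim\ker\overline{\boldsymbol\Delta}_m\hat f: m\in\mathbb Z_{\ge0}\}$; it is presupposed that this maximum exists. *)

theory Defs
  imports "HOL-Analysis.Analysis" "HOL-Analysis.Finite_Function_Topology"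
begin

(* The coordinates of R^d are indexed by a finite linearly ordered type 'd with CARD('d) = d;
   the order on 'd is only used for the lexicographical order of multi-indices and for fixing
   the order in which iterated partial derivatives are taken. *)

type_synonym 'd point = "(real, 'd) vec"
type_synonym 'd mindex = "(nat, 'd) vec"

section \<open>Multi-indices and partial derivatives\<close>

definition mlength :: "'d::finite mindex \<Rightarrow> nat" where
  "mlength \<alpha> = (\<Sum>i\<in>UNIV. \<alpha> $ i)"

definition mbinom :: "'d::finite mindex \<Rightarrow> 'd mindex \<Rightarrow> nat" where
  "mbinom \<alpha> \<beta> = (\<Prod>i\<in>UNIV. (\<alpha> $ i) choose (\<beta> $ i))"

definition mpower :: "'d::finite point \<Rightarrow> 'd mindex \<Rightarrow> real" where
  "mpower x \<alpha> = (\<Prod>i\<in>UNIV. (x $ i) ^ (\<alpha> $ i))"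

definition grlex_less :: "'d::{finite,linorder} mindex \<Rightarrow> 'd mindex \<Rightarrow> bool" where
  "grlex_less \<alpha> \<beta> \<longleftrightarrow> mlength \<alpha> < mlength \<beta> \<or>
     (mlength \<alpha> = mlength \<beta> \<and> (\<exists>i. \<alpha> $ i < \<beta> $ i \<and> (\<forall>j<i. \<alpha> $ j = \<beta> $ j)))"

definition dbar :: "nat \<Rightarrow> nat \<Rightarrow> nat" where
  "dbar d l = fact (d + l) div (fact l * fact d)"

definition mindex_list :: "nat \<Rightarrow> 'd::{finite,linorder} mindex list" where
  "mindex_list l = (THE as. set as = {\<alpha>. mlength \<alpha> \<le> l} \<and> sorted_wrt grlex_less as)"

definition partial :: "'d::finite \<Rightarrow> ('d point \<Rightarrow> complex) \<Rightarrow> 'd point \<Rightarrow> complex" where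
  "partial i g x = vector_derivative (\<lambda>t. g (x + t *\<^sub>R axis i 1)) (at 0)"

definition mderiv :: "'d::{finite,linorder} mindex \<Rightarrow> ('d point \<Rightarrow> complex) \<Rightarrow> 'd point \<Rightarrow> complex" where
  "mderiv \<alpha> g = foldr (\<lambda>i. partial i ^^ (\<alpha> $ i)) (sorted_list_of_set UNIV) g"

(* C^infinity: every iterated partial derivative, in any order, is differentiable. *)
definition smooth :: "('d::finite point \<Rightarrow> complex) \<Rightarrow> bool" where
  "smooth g \<longleftrightarrow> (\<forall>js. foldr partial js g differentiable_on UNIV)"


section \<open>Tempered distributions and the Fourier transform\<close>

definition schwartz :: "('d::{finite,linorder} point \<Rightarrow> complex) set" where
  "schwartz = {\<phi>. smooth \<phi> \<and>
     (\<forall>\<alpha> \<beta>. bdd_above (range (\<lambda>x. \<bar>mpower x \<alpha>\<bar> * cmod (mderiv \<beta> \<phi> x))))}"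

definition schwartz_seminorm ::
    "'d::{finite,linorder} mindex \<Rightarrow> 'd mindex \<Rightarrow> ('d point \<Rightarrow> complex) \<Rightarrow> real" where
  "schwartz_seminorm \<alpha> \<beta> \<phi> = (SUP x. \<bar>mpower x \<alpha>\<bar> * cmod (mderiv \<beta> \<phi> x))"

definition schwartz_topology :: "('d::{finite,linorder} point \<Rightarrow> complex) topology" where
  "schwartz_topology = topology_generated_by
     {{\<phi> \<in> schwartz. schwartz_seminorm \<alpha> \<beta> (\<lambda>x. \<phi> x - \<psi> x) < r} | \<alpha> \<beta> \<psi> r. \<psi> \<in> schwartz}"

(* Only the values of u on Schwartz functions are meaningful. *)
definition tempered_distribution :: "(('d::{finite,linorder} point \<Rightarrow> complex) \<Rightarrow> complex) \<Rightarrow> bool" where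
  "tempered_distribution u \<longleftrightarrow>
     (\<forall>\<phi>\<in>schwartz. \<forall>\<psi>\<in>schwartz. u (\<lambda>x. \<phi> x + \<psi> x) = u \<phi> + u \<psi>) \<and>
     (\<forall>c. \<forall>\<phi>\<in>schwartz. u (\<lambda>x. c * \<phi> x) = c * u \<phi>) \<and>
     continuous_map schwartz_topology euclidean u"

definition distribution_support :: "(('d::finite point \<Rightarrow> complex) \<Rightarrow> complex) \<Rightarrow> 'd point set" where
  "distribution_support u = - \<Union>{U. open U \<and>
     (\<forall>\<phi>. smooth \<phi> \<and> compact (closure {x. \<phi> x \<noteq> 0}) \<and> closure {x. \<phi> x \<noteq> 0} \<subseteq> U \<longrightarrow> u \<phi> = 0)}"

definition fourier :: "('d::finite point \<Rightarrow> complex) \<Rightarrow> 'd point \<Rightarrow> complex" where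
  "fourier \<phi> \<xi> = (2 * pi) powr (- real CARD('d) / 2) *\<^sub>R
     (LINT x|lborel. \<phi> x * exp (- \<i> * complex_of_real (\<xi> \<bullet> x)))"

(* The Fourier transform of a tempered distribution u is the distribution \<phi> \<mapsto> u (fourier \<phi>).
   If u is compactly supported, it is given by integration against a smooth function,
   which is unique and is denoted here by fourier_distr u. *)
definition fourier_distr ::
    "(('d::{finite,linorder} point \<Rightarrow> complex) \<Rightarrow> complex) \<Rightarrow> 'd point \<Rightarrow> complex" where
  "fourier_distr u = (THE g. smooth g \<and>
     (\<forall>\<phi>\<in>schwartz. integrable lborel (\<lambda>\<xi>. g \<xi> * \<phi> \<xi>) \<and>
        u (fourier \<phi>) = (LINT \<xi>|lborel. g \<xi> * \<phi> \<xi>)))"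


section \<open>Real polynomials in d variables\<close>

(* A polynomial is the finitely supported family of its coefficients; ring operations
   and the real vector space structure are the library ones. *)
type_synonym 'd polynomial = "'d mindex \<Rightarrow>\<^sub>0 real"

definition Const :: "real \<Rightarrow> 'd::finite polynomial" where
  "Const c = Poly_Mapping.single 0 c"

definition Var :: "'d::finite \<Rightarrow> 'd polynomial" where
  "Var i = Poly_Mapping.single (axis i 1) 1"

definition poly_shift :: "'d::finite point \<Rightarrow> 'd polynomial \<Rightarrow> 'd polynomial" where
  "poly_shift h P = (\<Sum>\<alpha>\<in>Poly_Mapping.keys P.
     Const (Poly_Mapping.lookup P \<alpha>) * (\<Prod>i\<in>UNIV. (Var i + Const (h $ i)) ^ (\<alpha> $ i)))"

definition shift_invariant :: "'d::finite polynomial set \<Rightarrow> bool" where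
  "shift_invariant S \<longleftrightarrow> (\<forall>P\<in>S. \<forall>h. poly_shift h P \<in> S)"

(* P(-iD), using (-iD)^\<alpha> = (-i)^|\<alpha>| D^\<alpha>. *)
definition poly_diff_op ::
    "'d::{finite,linorder} polynomial \<Rightarrow> ('d point \<Rightarrow> complex) \<Rightarrow> 'd point \<Rightarrow> complex" where
  "poly_diff_op P g \<xi> = (\<Sum>\<alpha>\<in>Poly_Mapping.keys P.
     complex_of_real (Poly_Mapping.lookup P \<alpha>) * (- \<i>) ^ mlength \<alpha> * mderiv \<alpha> g \<xi>)"

definition lattice_pt :: "(int, 'd::finite) vec \<Rightarrow> 'd point" where
  "lattice_pt n = (\<chi> i. 2 * pi * real_of_int (n $ i))"

definition V_space :: "(('d::{finite,linorder} point \<Rightarrow> complex) \<Rightarrow> complex) \<Rightarrow> 'd polynomial set" where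
  "V_space f = {P. \<forall>k. k \<noteq> 0 \<longrightarrow> poly_diff_op P (fourier_distr f) (lattice_pt k) = 0}"

(* The greatest element, with respect to inclusion. *)
definition V_sh :: "(('d::{finite,linorder} point \<Rightarrow> complex) \<Rightarrow> complex) \<Rightarrow> 'd polynomial set" where
  "V_sh f = (GREATEST W. subspace W \<and> shift_invariant W \<and> W \<subseteq> V_space f)"


section \<open>The Strang--Fix matrices and their kernels\<close>

(* Rows and columns are numbered from 0: the multi-index \<alpha>^(k+1) is mindex_list l ! k. *)
definition D_matrix ::
    "nat \<Rightarrow> ('d::{finite,linorder} point \<Rightarrow> complex) \<Rightarrow> 'd point \<Rightarrow> nat \<Rightarrow> nat \<Rightarrow> complex" where
  "D_matrix l g \<xi> j k =
     (let \<alpha>j = mindex_list l ! j; \<alpha>k = mindex_list l ! k in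
      if \<alpha>j \<le> \<alpha>k
      then of_nat (mbinom \<alpha>k \<alpha>j) * (- \<i>) ^ (mlength \<alpha>k - mlength \<alpha>j) * mderiv (\<alpha>k - \<alpha>j) g \<xi>
      else 0)"

(* Row (n, j) of the stacked matrix is row j of the block belonging to n. *)
definition Delta_rows :: "nat \<Rightarrow> ((int, 'd::finite) vec \<times> nat) set" where
  "Delta_rows l = {n. n \<noteq> 0} \<times> {..<dbar CARD('d) l}"

definition Delta_matrix ::
    "nat \<Rightarrow> ('d::{finite,linorder} point \<Rightarrow> complex) \<Rightarrow> (int, 'd) vec \<times> nat \<Rightarrow> nat \<Rightarrow> complex" where
  "Delta_matrix l g = (\<lambda>(n, j) k. D_matrix l g (lattice_pt n) j k)"

(* The real kernel of a complex matrix with row index set R and m columns; R^m is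
   represented as the space of finitely supported v :: nat \<Rightarrow>\<^sub>0 real vanishing off {..<m}. *)
definition mat_ker :: "'r set \<Rightarrow> nat \<Rightarrow> ('r \<Rightarrow> nat \<Rightarrow> complex) \<Rightarrow> (nat \<Rightarrow>\<^sub>0 real) set" where
  "mat_ker R m M = {v. Poly_Mapping.keys v \<subseteq> {..<m} \<and>
     (\<forall>r\<in>R. (\<Sum>k<m. M r k * complex_of_real (Poly_Mapping.lookup v k)) = 0)}"

definition Delta_ker ::
    "nat \<Rightarrow> (('d::{finite,linorder} point \<Rightarrow> complex) \<Rightarrow> complex) \<Rightarrow> (nat \<Rightarrow>\<^sub>0 real) set" where
  "Delta_ker l f = mat_ker (Delta_rows l) (dbar CARD('d) l) (Delta_matrix l (fourier_distr f))"

definition has_strang_fix_order ::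
    "(('d::{finite,linorder} point \<Rightarrow> complex) \<Rightarrow> complex) \<Rightarrow> bool" where
  "has_strang_fix_order f \<longleftrightarrow> (\<exists>l. \<forall>m. dim (Delta_ker m f) \<le> dim (Delta_ker l f))"

(* Meaningful only if has_strang_fix_order f, i.e. if the maximum is attained. *)
definition strang_fix_order ::
    "(('d::{finite,linorder} point \<Rightarrow> complex) \<Rightarrow> complex) \<Rightarrow> nat" where
  "strang_fix_order f =
     (LEAST l. dim (Delta_ker l f) = Max (range (\<lambda>m. dim (Delta_ker m f))))"

definition V_tilde :: "(('d::{finite,linorder} point \<Rightarrow> complex) \<Rightarrow> complex) \<Rightarrow> 'd polynomial set" where
  "V_tilde f = (let L = strang_fix_order f in
     {(\<Sum>k<dbar CARD('d) L. Poly_Mapping.single (mindex_list L ! k) (Poly_Mapping.lookup v k)) | v.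
        v \<in> Delta_ker L f})"

end

theory Submission
  imports Defs
begin

text \<open>By Taylor's formula \<open>P(\<cdot> + h) = \<Sum>\<beta>. h\<^sup>\<beta> D\<^sup>\<beta>P / \<beta>!\<close>, a shift-invariant subspace of \<open>\<V>\<close>
  contains with \<open>P\<close> all its derivatives, so \<open>\<V>\<^sub>s\<^sub>h\<close> consists of the polynomials all of whose
  divided derivatives \<open>D\<^sup>\<beta>P / \<beta>!\<close> lie in \<open>\<V>\<close>. Row \<open>j\<close> of the block at \<open>2\<pi>n\<close>, applied to the
  coefficients of \<open>P\<close>, is the condition at \<open>2\<pi>n\<close> for the divided derivative of index
  \<open>\<alpha>\<^sup>(\<^sup>j\<^sup>)\<close>; hence the kernel of order \<open>l\<close> is the part of \<open>\<V>\<^sub>s\<^sub>h\<close> of degree at most \<open>l\<close>.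
  These parts increase with \<open>l\<close>, and since their dimension is maximal at \<open>L\<close>, they are constant from
  there on.\<close>

section \<open>Linear extension from the basis of finitely supported families\<close>

lemma lookup_scaleR [simp]:
  "Poly_Mapping.lookup (c *\<^sub>R p) k = c *\<^sub>R Poly_Mapping.lookup p k"
proof -
  have "finite {x. c *\<^sub>R Poly_Mapping.lookup p x \<noteq> 0}"
    by (rule finite_subset[OF _ finite_lookup[of p]]) auto
  then show ?thesis by (simp add: scaleR_poly_mapping_def)
qed

lemma scaleR_single: "c *\<^sub>R Poly_Mapping.single a x = Poly_Mapping.single a (c *\<^sub>R x)"
  by (rule poly_mapping_eqI) (simp add: lookup_single when_def)

text \<open>The real-linear map with prescribed values on the basis. Divided derivatives, the
  operators P(-iD) and the passage from vectors to polynomials are all instances, so their linearity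
  is proved once.\<close>

definition lin_ext :: "('a \<Rightarrow> 'b::real_vector) \<Rightarrow> ('a \<Rightarrow>\<^sub>0 real) \<Rightarrow> 'b" where
  "lin_ext F p = (\<Sum>a\<in>Poly_Mapping.keys p. Poly_Mapping.lookup p a *\<^sub>R F a)"

lemma lin_ext_superset:
  assumes "finite A" "Poly_Mapping.keys p \<subseteq> A"
  shows "lin_ext F p = (\<Sum>a\<in>A. Poly_Mapping.lookup p a *\<^sub>R F a)"
  unfolding lin_ext_def using assms
  by (intro sum.mono_neutral_left) (auto simp: in_keys_iff)

lemma linear_lin_ext: "linear (lin_ext F)"
proof (rule linearI)
  fix p q :: "'a \<Rightarrow>\<^sub>0 real" and c :: real
  let ?A = "Poly_Mapping.keys p \<union> Poly_Mapping.keys q"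
  have "lin_ext F (p + q) = (\<Sum>a\<in>?A. Poly_Mapping.lookup (p + q) a *\<^sub>R F a)"
    by (intro lin_ext_superset keys_add) auto
  also have "\<dots> = lin_ext F p + lin_ext F q"
    by (simp add: lin_ext_superset[of ?A] lookup_add scaleR_add_left sum.distrib)
  finally show "lin_ext F (p + q) = lin_ext F p + lin_ext F q" .
  have "lin_ext F (c *\<^sub>R p) = (\<Sum>a\<in>Poly_Mapping.keys p. Poly_Mapping.lookup (c *\<^sub>R p) a *\<^sub>R F a)"
    by (intro lin_ext_superset) (auto simp: in_keys_iff)
  then show "lin_ext F (c *\<^sub>R p) = c *\<^sub>R lin_ext F p"
    by (simp add: lin_ext_def scaleR_sum_right)
qed

lemma lin_ext_single [simp]: "lin_ext F (Poly_Mapping.single a c) = c *\<^sub>R F a"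
  by (subst lin_ext_superset[of "{a}"]) auto

lemma lin_ext_single_one: "lin_ext (\<lambda>a. Poly_Mapping.single a 1) p = p"
  by (rule poly_mapping_eqI)
    (simp add: lin_ext_def lookup_sum lookup_single when_def in_keys_iff if_distrib[of "(*) _"] cong: if_cong)

text \<open>Reduces identities between composed linear maps to basis elements;
  \<open>hasse_hasse\<close> and \<open>D_matrix_mult\<close> are brought down to monomials this
  way.\<close>

lemma linear_comp_lin_ext:
  assumes "linear L"
  shows "L (lin_ext F p) = lin_ext (\<lambda>a. L (F a)) p"
  by (simp add: lin_ext_def linear_sum[OF assms] linear_cmul[OF assms])

lemma lin_ext_sum_scaleR:
  "lin_ext (\<lambda>a. \<Sum>i\<in>I. c i *\<^sub>R F i a) p = (\<Sum>i\<in>I. c i *\<^sub>R lin_ext (F i) p)"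
  unfolding lin_ext_def scaleR_sum_right
  by (subst sum.swap) (simp add: mult.commute)

lemma lin_ext_cong:
  "(\<And>a. a \<in> Poly_Mapping.keys p \<Longrightarrow> F a = G a) \<Longrightarrow> lin_ext F p = lin_ext G p"
  by (simp add: lin_ext_def)

section \<open>Lengths and binomials of multi-indices\<close>

lemma mlength_mono: "(\<alpha> :: 'd::finite mindex) \<le> \<beta> \<Longrightarrow> mlength \<alpha> \<le> mlength \<beta>"
  by (auto simp: mlength_def less_eq_vec_def intro: sum_mono)

lemma mlength_diff:
  "(\<beta> :: 'd::finite mindex) \<le> \<alpha> \<Longrightarrow> mlength (\<alpha> - \<beta>) = mlength \<alpha> - mlength \<beta>"
  by (auto simp: mlength_def less_eq_vec_def intro: sum_subtractf_nat)

lemma mbinom_eq_0: "\<not> \<beta> \<le> (\<alpha> :: 'd::finite mindex) \<Longrightarrow> mbinom \<alpha> \<beta> = 0"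
  by (auto simp: mbinom_def less_eq_vec_def not_le binomial_eq_0_iff)

text \<open>Both sides count pairs of disjoint subsets of sizes \<open>b\<close> and
  \<open>a\<close> in a set of size \<open>g\<close>. If \<open>a + b\<close> exceeds
  \<open>g\<close>, both vanish, so truncated subtraction does no harm.\<close>

lemma choose_mult_choose_diff:
  "(g choose b) * ((g - b) choose a) = ((a + b) choose a) * (g choose (a + b))"
proof (cases "a + b \<le> g")
  case True
  then show ?thesis
    using choose_mult[of b "a + b" g] binomial_symmetric[of a "a + b"] by (simp add: mult.commute)
next
  case False
  then show ?thesis by (cases "b \<le> g") (auto simp: binomial_eq_0)
qed

lemma mbinom_mult_mbinom_diff:
  "mbinom \<gamma> \<beta> * mbinom (\<gamma> - \<beta>) \<alpha> = mbinom (\<alpha> + \<beta>) \<alpha> * mbinom \<gamma> (\<alpha> + \<beta>)"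
  by (simp add: mbinom_def choose_mult_choose_diff flip: prod.distrib)

section \<open>Counting and enumerating multi-indices of bounded length\<close>

text \<open>Stars and bars: appending the slack \<open>l - mlength \<alpha>\<close> as one more
  entry turns the multi-indices of length at most \<open>l\<close> into the lists of d + 1 naturals
  with sum exactly \<open>l\<close>.\<close>

lemma card_mlength_le:
  "card {\<alpha> :: 'd::finite mindex. mlength \<alpha> \<le> l} = (CARD('d) + l) choose l"
proof -
  define n where "n = CARD('d)"
  obtain e :: "nat \<Rightarrow> 'd" where e: "bij_betw e {..<n} UNIV"
    using ex_bij_betw_nat_finite[of "UNIV :: 'd set"] by (auto simp: n_def lessThan_atLeast0)
  define to_list where
    "to_list = (\<lambda>\<alpha> :: 'd mindex. map (\<lambda>i. \<alpha> $ e i) [0..<n] @ [l - mlength \<alpha>])"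
  define of_list where
    "of_list = (\<lambda>xs :: nat list. \<chi> i. xs ! inv_into {..<n} e i)"
  have e_inv [simp]: "e (inv_into {..<n} e i) = i" for i
    using e by (simp add: bij_betw_inv_into_right)
  have inv_e [simp]: "inv_into {..<n} e (e i) = i" if "i < n" for i
    using e that by (simp add: bij_betw_inv_into_left)
  have inv_less [simp]: "inv_into {..<n} e i < n" for i
    using bij_betw_inv_into[OF e] by (auto simp: bij_betw_def)
  have mlength_e: "mlength \<alpha> = (\<Sum>i<n. \<alpha> $ e i)" for \<alpha>
    unfolding mlength_def using e by (rule sum.reindex_bij_betw[symmetric])
  have "bij_betw to_list {\<alpha>. mlength \<alpha> \<le> l} {xs. length xs = n + 1 \<and> sum_list xs = l}"
  proof (rule bij_betw_byWitness[where f' = of_list])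
    show "\<forall>\<alpha>\<in>{\<alpha>. mlength \<alpha> \<le> l}. of_list (to_list \<alpha>) = \<alpha>"
      by (auto simp: to_list_def of_list_def nth_append vec_eq_iff)
    have *: "mlength (of_list xs) = sum_list (butlast xs)" if "length xs = n + 1" for xs
      using that inv_e unfolding lessThan_atLeast0
      by (simp add: mlength_e of_list_def sum_list_sum_nth nth_butlast lessThan_atLeast0)
    have **: "sum_list xs = sum_list (butlast xs) + last xs" if "length xs = n + 1" for xs :: "nat list"
      using that by (cases xs rule: rev_cases) auto
    show "\<forall>xs\<in>{xs. length xs = n + 1 \<and> sum_list xs = l}. to_list (of_list xs) = xs"
    proof safe
      fix xs :: "nat list" assume xs: "length xs = n + 1" "l = sum_list xs"
      have "map (\<lambda>i. of_list xs $ e i) [0..<n] = butlast xs"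
        using xs by (intro nth_equalityI) (auto simp: of_list_def nth_butlast)
      moreover have "sum_list xs - mlength (of_list xs) = last xs"
        using *[OF xs(1)] **[OF xs(1)] by simp
      ultimately show "to_list (of_list xs) = xs"
        using xs by (auto simp: to_list_def intro: append_butlast_last_id)
    qed
    show "to_list ` {\<alpha>. mlength \<alpha> \<le> l} \<subseteq> {xs. length xs = n + 1 \<and> sum_list xs = l}"
      by (auto simp: to_list_def mlength_e interv_sum_list_conv_sum_set_nat lessThan_atLeast0)
    show "of_list ` {xs. length xs = n + 1 \<and> sum_list xs = l} \<subseteq> {\<alpha>. mlength \<alpha> \<le> l}"
      using * ** by auto
  qed
  then show ?thesis
    by (simp add: bij_betw_same_card card_length_sum_list n_def add.commute)
qed

lemma dbar_eq_card: "dbar CARD('d) l = card {\<alpha> :: 'd::finite mindex. mlength \<alpha> \<le> l}"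
  unfolding dbar_def card_mlength_le
  by (subst binomial_fact') (auto)

text \<open>An infinite set has \<open>card\<close> equal to 0, so the positive count already yields
  finiteness.\<close>

lemma finite_mlength_le: "finite {\<alpha> :: 'd::finite mindex. mlength \<alpha> \<le> l}"
  by (rule card_ge_0_finite) (simp add: card_mlength_le)

text \<open>Justifies the definite description in \<open>mindex_list\<close>:
  \<open>grlex_less\<close> is a strict linear order, and a finite set has exactly one strictly
  increasing enumeration.\<close>

lemma ex1_mindex_list:
  "\<exists>!as :: 'd::{finite,linorder} mindex list.
     set as = {\<alpha>. mlength \<alpha> \<le> l} \<and> sorted_wrt grlex_less as"
proof -
  have irrefl: "\<not> grlex_less \<alpha> \<alpha>" for \<alpha> :: "'d mindex"
    by (auto simp: grlex_less_def)
  have trans: "grlex_less \<alpha> \<gamma>" if "grlex_less \<alpha> \<beta>" "grlex_less \<beta> \<gamma>" for \<alpha> \<beta> \<gamma> :: "'d mindex"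
  proof -
    have "\<exists>k. \<alpha> $ k < \<gamma> $ k \<and> (\<forall>m<k. \<alpha> $ m = \<gamma> $ m)"
      if "\<alpha> $ i < \<beta> $ i" "\<forall>m<i. \<alpha> $ m = \<beta> $ m" "\<beta> $ j < \<gamma> $ j" "\<forall>m<j. \<beta> $ m = \<gamma> $ m" for i j
      \<comment> \<open>If the first differences of the two pairs are at \<open>i\<close> and
        \<open>j\<close>, that of the outer pair is at the smaller one.\<close>
      using that by (intro exI[of _ "min i j"], cases i j rule: linorder_cases) auto
    then show ?thesis using that by (fastforce simp: grlex_less_def)
  qed
  have total: "grlex_less \<alpha> \<beta> \<or> grlex_less \<beta> \<alpha>" if "\<alpha> \<noteq> \<beta>" for \<alpha> \<beta> :: "'d mindex"
  proof -
    \<comment> \<open>The first coordinate of disagreement decides the comparison when the lengths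
      agree.\<close>
    define i where "i = Min {i. \<alpha> $ i \<noteq> \<beta> $ i}"
    have ne: "{i. \<alpha> $ i \<noteq> \<beta> $ i} \<noteq> {}" using that by (auto simp: vec_eq_iff)
    have "\<alpha> $ i \<noteq> \<beta> $ i" using Min_in[OF _ ne] by (simp add: i_def)
    moreover have "\<alpha> $ j = \<beta> $ j" if "j < i" for j
    proof (rule ccontr)
      assume "\<alpha> $ j \<noteq> \<beta> $ j"
      then have "i \<le> j" unfolding i_def by (intro Min_le) auto
      with that show False by simp
    qed
    ultimately show ?thesis
      by (metis grlex_less_def linorder_neqE_nat)
  qed
  interpret grlex: linorder "\<lambda>\<alpha> \<beta> :: 'd mindex. \<alpha> = \<beta> \<or> grlex_less \<alpha> \<beta>" grlex_less
  proof
    show "grlex_less \<alpha> \<beta> \<longleftrightarrow> (\<alpha> = \<beta> \<or> grlex_less \<alpha> \<beta>) \<and> \<not> (\<beta> = \<alpha> \<or> grlex_less \<beta> \<alpha>)" for \<alpha> \<beta> :: "'d mindex"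
      using irrefl trans[of \<alpha> \<beta> \<alpha>] by blast
    show "\<alpha> = \<gamma> \<or> grlex_less \<alpha> \<gamma>"
      if "\<alpha> = \<beta> \<or> grlex_less \<alpha> \<beta>" "\<beta> = \<gamma> \<or> grlex_less \<beta> \<gamma>" for \<alpha> \<beta> \<gamma> :: "'d mindex"
      using that trans[of \<alpha> \<beta> \<gamma>] by blast
    show "\<alpha> = \<beta>"
      if "\<alpha> = \<beta> \<or> grlex_less \<alpha> \<beta>" "\<beta> = \<alpha> \<or> grlex_less \<beta> \<alpha>" for \<alpha> \<beta> :: "'d mindex"
      using that irrefl[of \<alpha>] trans[of \<alpha> \<beta> \<alpha>] by blast
    show "(\<alpha> = \<beta> \<or> grlex_less \<alpha> \<beta>) \<or> (\<beta> = \<alpha> \<or> grlex_less \<beta> \<alpha>)" for \<alpha> \<beta> :: "'d mindex"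
      using total[of \<alpha> \<beta>] by blast
  qed simp
  show ?thesis
  proof (rule ex_ex1I)
    show "\<exists>as :: 'd mindex list. set as = {\<alpha>. mlength \<alpha> \<le> l} \<and> sorted_wrt grlex_less as"
      using grlex.finite_sorted_distinct_unique[OF finite_mlength_le[of l]]
      unfolding grlex.strict_sorted_iff by blast
    show "as = bs"
      if "set as = {\<alpha>. mlength \<alpha> \<le> l} \<and> sorted_wrt grlex_less as"
        "set bs = {\<alpha>. mlength \<alpha> \<le> l} \<and> sorted_wrt grlex_less bs" for as bs :: "'d mindex list"
      using that by (intro grlex.strict_sorted_equal) auto
  qed
qed

lemma
  shows set_mindex_list: "set (mindex_list l :: 'd::{finite,linorder} mindex list) = {\<alpha>. mlength \<alpha> \<le> l}"
    and sorted_mindex_list: "sorted_wrt grlex_less (mindex_list l :: 'd mindex list)"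
  using theI'[OF ex1_mindex_list[of l]] unfolding mindex_list_def by auto

lemma distinct_mindex_list: "distinct (mindex_list l :: 'd::{finite,linorder} mindex list)"
proof -
  have "\<not> grlex_less \<alpha> \<alpha>" for \<alpha> :: "'d mindex"
    by (auto simp: grlex_less_def)
  then show ?thesis
    using sorted_mindex_list[of l, where 'd = 'd]
    by (metis distinct_conv_nth linorder_neqE_nat sorted_wrt_nth_less)
qed

text \<open>Translates between row or column numbers and multi-indices.\<close>

lemma bij_betw_mindex_list:
  "bij_betw (nth (mindex_list l)) {..<dbar CARD('d) l} {\<alpha> :: 'd::{finite,linorder} mindex. mlength \<alpha> \<le> l}"
  by (rule bij_betw_nth)
    (simp_all add: distinct_mindex_list set_mindex_list dbar_eq_card
       flip: distinct_card[OF distinct_mindex_list])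

section \<open>Constants, variables and monomials in the polynomial ring\<close>

lemma Const_mult: "Const c * p = c *\<^sub>R (p :: 'd::finite polynomial)"
proof -
  have "Const c * p = Const c * lin_ext (\<lambda>a. Poly_Mapping.single a 1) p"
    by (simp add: lin_ext_single_one)
  also have "\<dots> = c *\<^sub>R lin_ext (\<lambda>a. Poly_Mapping.single a 1) p"
    by (simp add: lin_ext_def sum_distrib_left scaleR_sum_right scaleR_single Const_def mult_single)
  finally show ?thesis by (simp add: lin_ext_single_one)
qed

lemma Const_power: "Const c ^ n = (Const (c ^ n) :: 'd::finite polynomial)"
  by (induction n) (simp_all add: Const_def mult_single)

lemma prod_Const: "(\<Prod>i\<in>I. Const (c i)) = (Const (\<Prod>i\<in>I. c i) :: 'd::finite polynomial)"
  by (induction I rule: infinite_finite_induct) (simp_all add: Const_def mult_single)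

lemma Var_power: "Var i ^ n = (Poly_Mapping.single (axis i n) 1 :: 'd::finite polynomial)"
proof (induction n)
  case 0
  have "axis i 0 = (0 :: 'd mindex)" by (simp add: vec_eq_iff axis_def)
  then show ?case by (simp only: power_0 single_one)
next
  case (Suc n)
  have "axis i 1 + axis i n = (axis i (Suc n) :: 'd mindex)" by (simp add: vec_eq_iff axis_def)
  with Suc show ?case by (simp add: Var_def mult_single)
qed

lemma prod_Var_power:
  "(\<Prod>i\<in>UNIV. Var i ^ (\<alpha> $ i)) = (Poly_Mapping.single \<alpha> 1 :: 'd::finite polynomial)"
proof -
  have "(\<Prod>i\<in>I. Var i ^ (\<alpha> $ i)) =
      (Poly_Mapping.single (\<Sum>i\<in>I. axis i (\<alpha> $ i)) 1 :: 'd polynomial)" for I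
    by (induction I rule: infinite_finite_induct) (simp_all add: Var_power mult_single)
  moreover have "(\<Sum>i\<in>UNIV. axis i (\<alpha> $ i)) = \<alpha>"
    by (simp add: vec_eq_iff axis_def)
  ultimately show ?thesis by simp
qed

section \<open>Divided derivatives and Taylor's formula\<close>

text \<open>Where \<open>\<beta> \<le> \<alpha>\<close> fails, the truncated exponent is
  meaningless, but the binomial is 0 and the monomial vanishes as it should.\<close>

definition hasse_monom :: "'d::finite mindex \<Rightarrow> 'd mindex \<Rightarrow> 'd polynomial" where
  "hasse_monom \<beta> \<alpha> = Poly_Mapping.single (\<alpha> - \<beta>) (real (mbinom \<alpha> \<beta>))"

text \<open>\<open>hasse \<beta> P\<close> is the divided derivative \<open>D\<^sup>\<beta>P / \<beta>!\<close>.\<close>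

definition hasse :: "'d::finite mindex \<Rightarrow> 'd polynomial \<Rightarrow> 'd polynomial" where
  "hasse \<beta> = lin_ext (hasse_monom \<beta>)"

lemma linear_hasse: "linear (hasse \<beta>)"
  unfolding hasse_def by (rule linear_lin_ext)

text \<open>Derivatives compose by adding their indices; the factor is what remains of the
  factorials. On monomials this is the identity for products of binomials.\<close>

lemma hasse_hasse: "hasse \<alpha> (hasse \<beta> P) = real (mbinom (\<alpha> + \<beta>) \<alpha>) *\<^sub>R hasse (\<alpha> + \<beta>) P"
proof -
  have diff: "\<gamma> - \<beta> - \<alpha> = \<gamma> - (\<alpha> + \<beta>)" for \<gamma> :: "'a mindex"
    by (simp add: vec_eq_iff add.commute)
  have "hasse \<alpha> (hasse_monom \<beta> \<gamma>) = real (mbinom (\<alpha> + \<beta>) \<alpha>) *\<^sub>R hasse_monom (\<alpha> + \<beta>) \<gamma>" for \<gamma>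
    using mbinom_mult_mbinom_diff[of \<gamma> \<beta> \<alpha>]
    by (simp add: hasse_def hasse_monom_def scaleR_single diff flip: of_nat_mult)
  then show ?thesis
    unfolding hasse_def[of \<beta>] linear_comp_lin_ext[OF linear_hasse]
    by (simp add: hasse_def flip: linear_cmul[OF linear_lin_ext]
        linear_comp_lin_ext[OF linear_scale_self])
qed

lemma hasse_0 [simp]: "hasse 0 P = P"
proof -
  have "hasse_monom 0 = (\<lambda>\<alpha> :: 'a mindex. Poly_Mapping.single \<alpha> 1)"
    by (rule ext) (simp add: hasse_monom_def mbinom_def)
  then show ?thesis by (simp add: hasse_def lin_ext_single_one)
qed

lemma hasse_eq_0:
  assumes "\<And>\<alpha>. \<alpha> \<in> Poly_Mapping.keys P \<Longrightarrow> mlength \<alpha> < mlength \<beta>"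
  shows "hasse \<beta> P = 0"
  unfolding hasse_def lin_ext_def
proof (rule sum.neutral, rule ballI)
  fix \<alpha> assume "\<alpha> \<in> Poly_Mapping.keys P"
  then have "\<not> \<beta> \<le> \<alpha>" using assms mlength_mono[of \<beta> \<alpha>] by fastforce
  then show "Poly_Mapping.lookup P \<alpha> *\<^sub>R hasse_monom \<beta> \<alpha> = 0"
    by (simp add: hasse_monom_def mbinom_eq_0)
qed

text \<open>The binomial theorem in each variable, multiplied out. Any finite \<open>A\<close>
  containing the relevant indices is allowed, so that all monomials of a polynomial can be expanded
  over one common set.\<close>

lemma prod_Var_add_Const_power:
  assumes "finite A" "{\<beta>. \<beta> \<le> \<alpha>} \<subseteq> A"
  shows "(\<Prod>i\<in>UNIV. (Var i + Const (h $ i)) ^ (\<alpha> $ i)) =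
    (\<Sum>\<beta>\<in>A. mpower h \<beta> *\<^sub>R hasse_monom \<beta> (\<alpha> :: 'd::finite mindex))"
proof -
  \<comment> \<open>Multi-indices below \<open>\<alpha>\<close> are the choice functions that arise
    when a product of sums is distributed.\<close>
  have bij: "bij_betw (\<lambda>\<beta> :: 'd mindex. vec_nth \<beta>) {\<beta>. \<beta> \<le> \<alpha>} (PiE UNIV (\<lambda>i. {..\<alpha> $ i}))"
    by (rule bij_betw_byWitness[where f' = vec_lambda]) (auto simp: less_eq_vec_def)
  have "(\<Prod>i\<in>UNIV. (Var i + Const (h $ i)) ^ (\<alpha> $ i)) =
      (\<Prod>i\<in>UNIV. \<Sum>k\<le>\<alpha> $ i. of_nat ((\<alpha> $ i) choose k) * Const (h $ i) ^ k * Var i ^ (\<alpha> $ i - k))"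
    by (subst add.commute) (simp add: binomial_ring)
  also have "\<dots> = (\<Sum>b\<in>PiE UNIV (\<lambda>i. {..\<alpha> $ i}). \<Prod>i\<in>UNIV.
      of_nat ((\<alpha> $ i) choose b i) * Const (h $ i) ^ b i * Var i ^ (\<alpha> $ i - b i))"
    by (rule prod_sum_PiE) auto
  also have "\<dots> = (\<Sum>\<beta> | \<beta> \<le> \<alpha>. \<Prod>i\<in>UNIV.
      of_nat ((\<alpha> $ i) choose (\<beta> $ i)) * Const (h $ i) ^ (\<beta> $ i) * Var i ^ (\<alpha> $ i - \<beta> $ i))"
    by (rule sum.reindex_bij_betw[OF bij, symmetric])
  also have "\<dots> = (\<Sum>\<beta> | \<beta> \<le> \<alpha>. mpower h \<beta> *\<^sub>R hasse_monom \<beta> \<alpha>)"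
  proof (rule sum.cong)
    fix \<beta>
    have of_nat: "of_nat n = (Const (real n) :: 'd polynomial)" for n
      by (simp add: Const_def)
    have "(\<Prod>i\<in>UNIV. of_nat ((\<alpha> $ i) choose (\<beta> $ i)) * Const (h $ i) ^ (\<beta> $ i) * Var i ^ (\<alpha> $ i - \<beta> $ i))
        = Const (real (mbinom \<alpha> \<beta>)) * Const (mpower h \<beta>) * (\<Prod>i\<in>UNIV. Var i ^ ((\<alpha> - \<beta>) $ i))"
      by (simp add: of_nat Const_power prod_Const prod.distrib mbinom_def mpower_def)
    also have "\<dots> = mpower h \<beta> *\<^sub>R hasse_monom \<beta> \<alpha>"
      by (simp add: prod_Var_power Const_def mult_single hasse_monom_def scaleR_single mult.commute
          del: vector_minus_component single_of_nat)
    finally show "(\<Prod>i\<in>UNIV. of_nat ((\<alpha> $ i) choose (\<beta> $ i)) * Const (h $ i) ^ (\<beta> $ i) * Var i ^ (\<alpha> $ i - \<beta> $ i))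
        = mpower h \<beta> *\<^sub>R hasse_monom \<beta> \<alpha>" .
  qed simp
  also have "\<dots> = (\<Sum>\<beta>\<in>A. mpower h \<beta> *\<^sub>R hasse_monom \<beta> \<alpha>)"
    using assms by (intro sum.mono_neutral_left) (auto simp: hasse_monom_def mbinom_eq_0)
  finally show ?thesis .
qed

lemma poly_shift_eq_sum_hasse:
  assumes "Poly_Mapping.keys P \<subseteq> {\<alpha>. mlength \<alpha> \<le> N}"
  shows "poly_shift h P = (\<Sum>\<beta> | mlength \<beta> \<le> N. mpower h \<beta> *\<^sub>R hasse \<beta> P)"
proof -
  have "poly_shift h P = lin_ext (\<lambda>\<alpha>. \<Prod>i\<in>UNIV. (Var i + Const (h $ i)) ^ (\<alpha> $ i)) P"
    by (simp add: poly_shift_def lin_ext_def Const_mult)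
  also have "\<dots> = lin_ext (\<lambda>\<alpha>. \<Sum>\<beta> | mlength \<beta> \<le> N. mpower h \<beta> *\<^sub>R hasse_monom \<beta> \<alpha>) P"
    using assms mlength_mono
    by (intro lin_ext_cong prod_Var_add_Const_power finite_mlength_le) fastforce
  also have "\<dots> = (\<Sum>\<beta> | mlength \<beta> \<le> N. mpower h \<beta> *\<^sub>R hasse \<beta> P)"
    by (simp add: lin_ext_sum_scaleR hasse_def)
  finally show ?thesis .
qed

section \<open>Polynomial functions that vanish identically\<close>

text \<open>Induction on the set \<open>I\<close> of variables, removing one at a time and invoking
  the one-variable case. The exponents are an abstract family \<open>e\<close> that \<open>I\<close>
  has to separate, which lets the statement survive the removal.\<close>

lemma coeffs_zero_if_vanishing:
  fixes c :: "'a \<Rightarrow> real" and e :: "'a \<Rightarrow> 'i \<Rightarrow> nat"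
  assumes "finite I" "finite A"
    and "\<And>a b. \<lbrakk>a \<in> A; b \<in> A; \<And>i. i \<in> I \<Longrightarrow> e a i = e b i\<rbrakk> \<Longrightarrow> a = b"
    and "\<And>h. (\<Sum>a\<in>A. c a * (\<Prod>i\<in>I. h i ^ e a i)) = 0"
    and "a \<in> A"
  shows "c a = 0"
  using assms
proof (induction I arbitrary: A a rule: finite_induct)
  case empty
  \<comment> \<open>With no variables left, separation leaves room for one element only.\<close>
  then have "A = {a}" by blast
  with empty show ?case by simp
next
  case (insert j I)
  define N where "N = Max ((\<lambda>b. e b j) ` A)"
  have N: "e b j \<le> N" if "b \<in> A" for b
    using that insert.prems by (simp add: N_def)
  have slice: "(\<Sum>b | b \<in> A \<and> e b j = n. c b * (\<Prod>i\<in>I. h i ^ e b i)) = 0" if "n \<le> N" for h n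
  proof -
    \<comment> \<open>With the other variables frozen, the slice sums are the coefficients of a
      polynomial in the value \<open>t\<close> of variable \<open>j\<close>.\<close>
    have "(\<Sum>n\<le>N. (\<Sum>b | b \<in> A \<and> e b j = n. c b * (\<Prod>i\<in>I. h i ^ e b i)) * t ^ n) = 0" for t
    proof -
      have "(\<Sum>n\<le>N. (\<Sum>b | b \<in> A \<and> e b j = n. c b * (\<Prod>i\<in>I. h i ^ e b i)) * t ^ n)
          = (\<Sum>n\<le>N. \<Sum>b | b \<in> A \<and> e b j = n. c b * (\<Prod>i\<in>I. h i ^ e b i) * t ^ e b j)"
        by (simp add: sum_distrib_right)
      also have "\<dots> = (\<Sum>b\<in>A. c b * (\<Prod>i\<in>I. h i ^ e b i) * t ^ e b j)"
        using N insert.prems by (intro sum.group) auto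
      also have "\<dots> = (\<Sum>b\<in>A. c b * (\<Prod>i\<in>insert j I. (h(j := t)) i ^ e b i))"
      proof (rule sum.cong)
        fix b
        have "(\<Prod>i\<in>I. (h(j := t)) i ^ e b i) = (\<Prod>i\<in>I. h i ^ e b i)"
          using insert.hyps by (intro prod.cong) auto
        then show "c b * (\<Prod>i\<in>I. h i ^ e b i) * t ^ e b j
            = c b * (\<Prod>i\<in>insert j I. (h(j := t)) i ^ e b i)"
          using insert.hyps by simp
      qed simp
      also have "\<dots> = 0" by (rule insert.prems)
      finally show ?thesis .
    qed
    then show ?thesis
      using that polyfun_eq_0[of "\<lambda>n. \<Sum>b | b \<in> A \<and> e b j = n. c b * (\<Prod>i\<in>I. h i ^ e b i)" N] by blast
  qed
  show ?case
  \<comment> \<open>Inside one slice the exponents of \<open>j\<close> agree, so the remaining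
    variables still separate its elements.\<close>
  proof (rule insert.IH[of "{b \<in> A. e b j = e a j}"])
    fix b b' assume "b \<in> {b \<in> A. e b j = e a j}" "b' \<in> {b \<in> A. e b j = e a j}"
      "\<And>i. i \<in> I \<Longrightarrow> e b i = e b' i"
    then show "b = b'" by (intro insert.prems(2)) auto
  next
    show "a \<in> {b \<in> A. e b j = e a j}" using insert.prems by simp
    show "finite {b \<in> A. e b j = e a j}" using insert.prems by simp
    show "(\<Sum>b | b \<in> A \<and> e b j = e a j. c b * (\<Prod>i\<in>I. h i ^ e b i)) = 0" for h
      using slice[of "e a j" h] N insert.prems by blast
  qed
qed

text \<open>The shifts are real while the coefficients are complex, so real and imaginary parts are
  treated separately.\<close>

lemma mpower_coeffs_zero:
  fixes c :: "'d::finite mindex \<Rightarrow> complex"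
  assumes "finite A" "\<And>h. (\<Sum>\<beta>\<in>A. mpower h \<beta> *\<^sub>R c \<beta>) = 0" "\<beta> \<in> A"
  shows "c \<beta> = 0"
proof -
  have *: "d \<beta> = 0" if "\<And>h. (\<Sum>\<beta>\<in>A. mpower h \<beta> * d \<beta>) = 0" for d :: "'d mindex \<Rightarrow> real"
  proof (rule coeffs_zero_if_vanishing[of UNIV A "\<lambda>\<beta> i. \<beta> $ i"])
    show "(\<Sum>\<beta>\<in>A. d \<beta> * (\<Prod>i\<in>UNIV. h i ^ (\<beta> $ i))) = 0" for h
      using that[of "\<chi> i. h i"] by (simp add: mpower_def mult.commute)
  qed (use assms in \<open>auto simp: vec_eq_iff\<close>)
  have "Re (c \<beta>) = 0"
    using arg_cong[OF assms(2), of Re] by (intro *[of "\<lambda>\<beta>. Re (c \<beta>)"]) simp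
  moreover have "Im (c \<beta>) = 0"
    using arg_cong[OF assms(2), of Im] by (intro *[of "\<lambda>\<beta>. Im (c \<beta>)"]) simp
  ultimately show ?thesis by (simp add: complex_eq_iff)
qed

section \<open>The largest shift-invariant subspace\<close>

lemma poly_diff_op_eq_lin_ext:
  "poly_diff_op P g \<xi> = lin_ext (\<lambda>\<alpha>. (- \<i>) ^ mlength \<alpha> * mderiv \<alpha> g \<xi>) P"
  by (simp add: poly_diff_op_def lin_ext_def scaleR_conv_of_real mult.assoc)

lemma linear_poly_diff_op: "linear (\<lambda>P. poly_diff_op P g \<xi>)"
  unfolding poly_diff_op_eq_lin_ext by (rule linear_lin_ext)

lemma subspace_V_space: "subspace (V_space f)"
proof (rule subspaceI)
  note lin = linear_poly_diff_op[of "fourier_distr f"]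
  show "0 \<in> V_space f"
    using linear_0[OF lin] by (simp add: V_space_def)
  show "P + Q \<in> V_space f" if "P \<in> V_space f" "Q \<in> V_space f" for P Q
    using that linear_add[OF lin] by (simp add: V_space_def)
  show "c *\<^sub>R P \<in> V_space f" if "P \<in> V_space f" for c P
    using that linear_cmul[OF lin] by (simp add: V_space_def)
qed

definition hasse_core :: "'d::finite polynomial set \<Rightarrow> 'd polynomial set" where
  "hasse_core V = {P. \<forall>\<beta>. hasse \<beta> P \<in> V}"

lemma subspace_hasse_core: "subspace V \<Longrightarrow> subspace (hasse_core V)"
  by (auto simp: subspace_def hasse_core_def linear_0[OF linear_hasse]
      linear_add[OF linear_hasse] linear_cmul[OF linear_hasse])

lemma hasse_core_subset: "hasse_core V \<subseteq> V"
proof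
  fix P assume "P \<in> hasse_core V"
  then have "hasse 0 P \<in> V" unfolding hasse_core_def by blast
  then show "P \<in> V" by simp
qed

lemma keys_bounded_mlength:
  obtains N where "Poly_Mapping.keys (P :: 'd::finite polynomial) \<subseteq> {\<alpha>. mlength \<alpha> \<le> N}"
  \<comment> \<open>For \<open>P = 0\<close> the \<open>Max\<close> of the empty set is unspecified,
    but the inclusion is then trivial.\<close>
  by (rule that[of "Max (mlength ` Poly_Mapping.keys P)"]) auto

text \<open>By \<open>hasse_hasse\<close> the core is closed under divided derivatives, and by
  Taylor's formula a shift is a linear combination of these.\<close>

lemma shift_invariant_hasse_core:
  assumes "subspace V"
  shows "shift_invariant (hasse_core V)"
  unfolding shift_invariant_def
proof (intro ballI allI)
  fix P :: "'a polynomial" and h :: "'a point" assume P: "P \<in> hasse_core V"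
  obtain N where N: "Poly_Mapping.keys P \<subseteq> {\<alpha>. mlength \<alpha> \<le> N}"
    using keys_bounded_mlength[of P] .
  have "hasse \<alpha> (hasse \<beta> P) \<in> V" for \<alpha> \<beta>
    using P assms by (simp add: hasse_hasse hasse_core_def subspace_scale)
  then have "hasse \<beta> P \<in> hasse_core V" for \<beta>
    by (simp add: hasse_core_def)
  then have "mpower h \<beta> *\<^sub>R hasse \<beta> P \<in> hasse_core V" for \<beta>
    by (rule subspace_scale[OF subspace_hasse_core[OF assms]])
  then show "poly_shift h P \<in> hasse_core V"
    unfolding poly_shift_eq_sum_hasse[OF N]
    by (rule subspace_sum[OF subspace_hasse_core[OF assms]])
qed

text \<open>For a linear functional \<open>\<Lambda>\<close>, the map \<open>h \<mapsto> \<Lambda> (P(\<cdot> + h))\<close> is a polynomial in \<open>h\<close> with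
  coefficients \<open>\<Lambda> (hasse \<beta> P)\<close>; if it vanishes identically, so do they.\<close>

lemma shift_invariant_subset_hasse_core:
  fixes f :: "('d::{finite,linorder} point \<Rightarrow> complex) \<Rightarrow> complex"
  assumes "shift_invariant W" "W \<subseteq> V_space f"
  shows "W \<subseteq> hasse_core (V_space f)"
proof
  fix P assume P: "P \<in> W"
  obtain N where N: "Poly_Mapping.keys P \<subseteq> {\<alpha>. mlength \<alpha> \<le> N}"
    using keys_bounded_mlength[of P] .
  have "poly_diff_op (hasse \<beta> P) (fourier_distr f) (lattice_pt k) = 0" if "k \<noteq> 0" for \<beta> k
  proof (cases "mlength \<beta> \<le> N")
    case True
    note lin = linear_poly_diff_op[of "fourier_distr f" "lattice_pt k"]
    have "poly_shift h P \<in> V_space f" for h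
      using P assms by (auto simp: shift_invariant_def)
    then have "poly_diff_op (poly_shift h P) (fourier_distr f) (lattice_pt k) = 0" for h
      using that by (simp add: V_space_def)
    then have "(\<Sum>\<beta> | mlength \<beta> \<le> N. mpower h \<beta> *\<^sub>R
        poly_diff_op (hasse \<beta> P) (fourier_distr f) (lattice_pt k)) = 0" for h
      by (simp add: poly_shift_eq_sum_hasse[OF N] linear_sum[OF lin] linear_cmul[OF lin])
    then show ?thesis
      using True by (intro mpower_coeffs_zero[OF finite_mlength_le[of N], where
            c = "\<lambda>\<beta>. poly_diff_op (hasse \<beta> P) (fourier_distr f) (lattice_pt k)"]) simp_all
  next
    case False
    then have "hasse \<beta> P = 0" using N by (intro hasse_eq_0) fastforce
    then show ?thesis by (simp add: poly_diff_op_def)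
  qed
  then show "P \<in> hasse_core (V_space f)"
    by (simp add: hasse_core_def V_space_def)
qed

text \<open>Also settles that the greatest element in \<open>V_sh\<close> exists: the core is
  admissible and contains every admissible \<open>W\<close>.\<close>

lemma V_sh_eq_hasse_core: "V_sh f = hasse_core (V_space f)"
  unfolding V_sh_def
proof (rule Greatest_equality)
  show "subspace (hasse_core (V_space f)) \<and> shift_invariant (hasse_core (V_space f)) \<and>
      hasse_core (V_space f) \<subseteq> V_space f"
    by (intro conjI subspace_hasse_core shift_invariant_hasse_core hasse_core_subset subspace_V_space)
qed (intro shift_invariant_subset_hasse_core, simp_all)

section \<open>Coefficient vectors and the kernels of the matrices\<close>

text \<open>Total on finitely supported vectors, hence linear without side conditions. Positions
  beyond the list give unspecified monomials, so later facts restrict the support to the first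
  \<open>dbar CARD('d) l\<close> positions.\<close>

definition poly_of_coeffs :: "nat \<Rightarrow> (nat \<Rightarrow>\<^sub>0 real) \<Rightarrow> 'd::{finite,linorder} polynomial" where
  "poly_of_coeffs l = lin_ext (\<lambda>k. Poly_Mapping.single (mindex_list l ! k) 1)"

lemma linear_poly_of_coeffs: "linear (poly_of_coeffs l)"
  unfolding poly_of_coeffs_def by (rule linear_lin_ext)

lemma poly_of_coeffs_eq_sum:
  assumes "Poly_Mapping.keys v \<subseteq> {..<m}"
  shows "poly_of_coeffs l v = (\<Sum>k<m. Poly_Mapping.single (mindex_list l ! k) (Poly_Mapping.lookup v k))"
  unfolding poly_of_coeffs_def lin_ext_superset[OF finite_lessThan assms]
  by (simp add: scaleR_single)

lemma lookup_poly_of_coeffs: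
  assumes "Poly_Mapping.keys v \<subseteq> {..<dbar CARD('d) l}" "k < dbar CARD('d) l"
  shows "Poly_Mapping.lookup (poly_of_coeffs l v) (mindex_list l ! k :: 'd::{finite,linorder} mindex)
    = Poly_Mapping.lookup v k"
proof -
  have "(mindex_list l ! j :: 'd mindex) = mindex_list l ! k \<longleftrightarrow> j = k" if "j < dbar CARD('d) l" for j
    using that assms(2) bij_betw_mindex_list[of l, where 'd = 'd] by (auto simp: bij_betw_def inj_on_def)
  then have "Poly_Mapping.lookup (poly_of_coeffs l v) (mindex_list l ! k :: 'd mindex)
      = (\<Sum>j<dbar CARD('d) l. if j = k then Poly_Mapping.lookup v j else 0)"
    unfolding poly_of_coeffs_eq_sum[OF assms(1)] lookup_sum
    by (intro sum.cong) (auto simp: lookup_single when_def)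
  then show ?thesis using assms(2) by simp
qed

lemma poly_of_coeffs_image:
  "poly_of_coeffs l ` {v. Poly_Mapping.keys v \<subseteq> {..<dbar CARD('d) l}} =
    {P :: 'd::{finite,linorder} polynomial. Poly_Mapping.keys P \<subseteq> {\<alpha>. mlength \<alpha> \<le> l}}"
proof safe
  fix v \<alpha> assume v: "Poly_Mapping.keys v \<subseteq> {..<dbar CARD('d) l}"
    and "\<alpha> \<in> Poly_Mapping.keys (poly_of_coeffs l v :: 'd polynomial)"
  then have "(\<Sum>k<dbar CARD('d) l. Poly_Mapping.lookup
      (Poly_Mapping.single (mindex_list l ! k) (Poly_Mapping.lookup v k)) \<alpha>) \<noteq> 0"
    by (simp add: in_keys_iff poly_of_coeffs_eq_sum[OF v] lookup_sum)
  then obtain k where "k < dbar CARD('d) l" "mindex_list l ! k = \<alpha>"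
    by (elim sum.not_neutral_contains_not_neutral) (auto simp: lookup_single when_def split: if_splits)
  then show "mlength \<alpha> \<le> l"
    using bij_betw_mindex_list[of l, where 'd = 'd] by (auto simp: bij_betw_def)
next
  fix P :: "'d polynomial" assume P: "Poly_Mapping.keys P \<subseteq> {\<alpha>. mlength \<alpha> \<le> l}"
  note bij = bij_betw_mindex_list[of l, where 'd = 'd]
  define idx where "idx = inv_into {..<dbar CARD('d) l} (nth (mindex_list l :: 'd mindex list))"
  define v where "v = lin_ext (\<lambda>\<alpha>. Poly_Mapping.single (idx \<alpha>) (1::real)) P"
  have idx: "idx \<alpha> < dbar CARD('d) l" "mindex_list l ! idx \<alpha> = \<alpha>" if "mlength \<alpha> \<le> l" for \<alpha>
    using that bij_betw_inv_into_right[OF bij] bij_betw_apply[OF bij_betw_inv_into[OF bij]]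
    by (auto simp: idx_def)
  have "Poly_Mapping.keys v \<subseteq> (\<Union>\<alpha>\<in>Poly_Mapping.keys P. {idx \<alpha>})"
    unfolding v_def lin_ext_def
    by (rule order.trans[OF keys_sum]) (auto simp: scaleR_single)
  then have "Poly_Mapping.keys v \<subseteq> {..<dbar CARD('d) l}"
    using P idx(1) by blast
  moreover have "poly_of_coeffs l v = lin_ext (\<lambda>\<alpha>. Poly_Mapping.single \<alpha> 1) P"
    unfolding v_def linear_comp_lin_ext[OF linear_poly_of_coeffs]
    using P idx by (intro lin_ext_cong) (auto simp: poly_of_coeffs_def)
  ultimately show "P \<in> poly_of_coeffs l ` {v. Poly_Mapping.keys v \<subseteq> {..<dbar CARD('d) l}}"
    by (intro image_eqI[of _ _ v]) (simp_all add: lin_ext_single_one)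
qed

text \<open>Entry \<open>(j, k)\<close> is P(-iD) applied to \<open>g\<close> at
  \<open>\<xi>\<close>, with P the divided derivative of the \<open>k\<close>-th monomial by the
  \<open>j\<close>-th index; the zero entries match the vanishing binomials.\<close>

lemma D_matrix_mult:
  assumes "Poly_Mapping.keys v \<subseteq> {..<m}"
  shows "(\<Sum>k<m. D_matrix l g \<xi> j k * complex_of_real (Poly_Mapping.lookup v k)) =
    poly_diff_op (hasse (mindex_list l ! j) (poly_of_coeffs l v)) g \<xi>"
proof -
  note lin = linear_poly_diff_op[of g \<xi>]
  let ?\<alpha> = "nth (mindex_list l)"
  have "D_matrix l g \<xi> j k = poly_diff_op (hasse_monom (?\<alpha> j) (?\<alpha> k)) g \<xi>" for k
    by (simp add: D_matrix_def hasse_monom_def poly_diff_op_eq_lin_ext mbinom_eq_0 mlength_diff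
        scaleR_conv_of_real Let_def)
  moreover have "poly_diff_op (hasse (?\<alpha> j) (poly_of_coeffs l v)) g \<xi> =
      lin_ext (\<lambda>k. poly_diff_op (hasse (?\<alpha> j) (Poly_Mapping.single (?\<alpha> k) 1)) g \<xi>) v"
    unfolding poly_of_coeffs_def linear_comp_lin_ext[OF linear_hasse] linear_comp_lin_ext[OF lin] ..
  ultimately show ?thesis
    by (simp add: hasse_def lin_ext_superset[OF finite_lessThan assms] scaleR_conv_of_real mult.commute)
qed

definition hasse_core_le :: "nat \<Rightarrow> 'd::finite polynomial set \<Rightarrow> 'd polynomial set" where
  "hasse_core_le l V = {P \<in> hasse_core V. Poly_Mapping.keys P \<subseteq> {\<alpha>. mlength \<alpha> \<le> l}}"

lemma Delta_ker_eq:
  fixes f :: "('d::{finite,linorder} point \<Rightarrow> complex) \<Rightarrow> complex"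
  shows "Delta_ker l f = {v. Poly_Mapping.keys v \<subseteq> {..<dbar CARD('d) l} \<and>
    poly_of_coeffs l v \<in> hasse_core_le l (V_space f)}"
proof -
  have "(\<forall>r\<in>Delta_rows l. (\<Sum>k<dbar CARD('d) l. Delta_matrix l (fourier_distr f) r k *
          complex_of_real (Poly_Mapping.lookup v k)) = 0) \<longleftrightarrow>
        poly_of_coeffs l v \<in> hasse_core_le l (V_space f)"
    if v: "Poly_Mapping.keys v \<subseteq> {..<dbar CARD('d) l}" for v
  proof -
    let ?P = "poly_of_coeffs l v :: 'd polynomial"
    have keys: "Poly_Mapping.keys ?P \<subseteq> {\<alpha>. mlength \<alpha> \<le> l}"
      using v poly_of_coeffs_image[of l, where 'd = 'd] by blast
    \<comment> \<open>The rows test only indices of length at most \<open>l\<close>; longer ones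
      exceed the degree and impose nothing.\<close>
    have high: "hasse \<beta> ?P = 0" if "\<not> mlength \<beta> \<le> l" for \<beta>
      using that keys by (intro hasse_eq_0) fastforce
    \<comment> \<open>For fixed \<open>j\<close>, the rows \<open>(n, j)\<close> over all nonzero
      \<open>n\<close> together express membership in \<open>V_space f\<close>.\<close>
    have "(\<forall>r\<in>Delta_rows l. (\<Sum>k<dbar CARD('d) l. Delta_matrix l (fourier_distr f) r k *
          complex_of_real (Poly_Mapping.lookup v k)) = 0) \<longleftrightarrow>
        (\<forall>j<dbar CARD('d) l. hasse (mindex_list l ! j) ?P \<in> V_space f)"
      by (auto simp: Delta_rows_def Delta_matrix_def V_space_def D_matrix_mult[OF v])
    also have "\<dots> \<longleftrightarrow> (\<forall>\<beta>\<in>{\<beta>. mlength \<beta> \<le> l}. hasse \<beta> ?P \<in> V_space f)"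
      using bij_betw_imp_surj_on[OF bij_betw_mindex_list[of l, where 'd = 'd], symmetric] by auto
    also have "\<dots> \<longleftrightarrow> ?P \<in> hasse_core_le l (V_space f)"
      using keys high subspace_0[OF subspace_V_space[of f]]
      by (auto simp: hasse_core_def hasse_core_le_def) metis
    finally show ?thesis .
  qed
  then show ?thesis
    unfolding Delta_ker_def mat_ker_def by blast
qed

lemma poly_of_coeffs_Delta_ker:
  "poly_of_coeffs l ` Delta_ker l f = hasse_core_le l (V_space (f :: ('d::{finite,linorder} point \<Rightarrow> complex) \<Rightarrow> complex))"
proof -
  have "hasse_core_le l (V_space f) \<subseteq>
      poly_of_coeffs l ` {v. Poly_Mapping.keys v \<subseteq> {..<dbar CARD('d) l}}"
    unfolding poly_of_coeffs_image by (auto simp: hasse_core_le_def)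
  then show ?thesis
    unfolding Delta_ker_eq by blast
qed

lemma inj_on_poly_of_coeffs:
  "inj_on (poly_of_coeffs l :: _ \<Rightarrow> 'd::{finite,linorder} polynomial)
     {v. Poly_Mapping.keys v \<subseteq> {..<dbar CARD('d) l}}"
proof (rule inj_onI)
  fix v w assume keys: "v \<in> {v. Poly_Mapping.keys v \<subseteq> {..<dbar CARD('d) l}}"
      "w \<in> {v. Poly_Mapping.keys v \<subseteq> {..<dbar CARD('d) l}}"
    and eq: "poly_of_coeffs l v = (poly_of_coeffs l w :: 'd polynomial)"
  have "Poly_Mapping.lookup v k = Poly_Mapping.lookup w k" if "k < dbar CARD('d) l" for k
    using keys eq that by (metis lookup_poly_of_coeffs mem_Collect_eq)
  moreover have "Poly_Mapping.lookup v k = Poly_Mapping.lookup w k" if "\<not> k < dbar CARD('d) l" for k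
    using keys that by (metis in_keys_iff lessThan_iff mem_Collect_eq subsetD)
  ultimately show "v = w" by (intro poly_mapping_eqI) blast
qed

section \<open>Dimension counts\<close>

lemma subspace_keys_subset: "subspace {p :: 'a \<Rightarrow>\<^sub>0 real. Poly_Mapping.keys p \<subseteq> A}"
proof (rule subspaceI)
  show "p + q \<in> {p. Poly_Mapping.keys p \<subseteq> A}"
    if "p \<in> {p. Poly_Mapping.keys p \<subseteq> A}" "q \<in> {p. Poly_Mapping.keys p \<subseteq> A}" for p q :: "'a \<Rightarrow>\<^sub>0 real"
    using that keys_add[of p q] by auto
qed (auto simp: in_keys_iff subset_iff)

lemma subspace_hasse_core_le:
  assumes "subspace V"
  shows "subspace (hasse_core_le l V)"
  using subspace_inter[OF subspace_hasse_core[OF assms] subspace_keys_subset]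
  by (simp add: hasse_core_le_def Int_def)

lemma keys_subset_span: "{p :: 'a \<Rightarrow>\<^sub>0 real. Poly_Mapping.keys p \<subseteq> A} \<subseteq> span ((\<lambda>a. Poly_Mapping.single a 1) ` A)"
proof
  fix p :: "'a \<Rightarrow>\<^sub>0 real" assume p: "p \<in> {p. Poly_Mapping.keys p \<subseteq> A}"
  show "p \<in> span ((\<lambda>a. Poly_Mapping.single a 1) ` A)"
    using p by (subst lin_ext_single_one[of p, symmetric], unfold lin_ext_def)
      (intro span_sum span_scale span_base, auto)
qed

lemma dim_image_eq_inj_on:
  fixes T :: "'a::real_vector \<Rightarrow> 'b::real_vector"
  assumes "linear T" "subspace S" "inj_on T S"
  shows "dim (T ` S) = dim S"
proof -
  obtain B where B: "B \<subseteq> S" "independent B" "S \<subseteq> span B" "card B = dim S"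
    using basis_exists by blast
  have span: "span B = S"
    using B assms(2) by (simp add: span_minimal subset_antisym)
  have "dim (T ` S) = card (T ` B)"
  proof (rule dim_eq_card)
    show "span (T ` B) = span (T ` S)"
      using span assms(1,2) by (metis linear_span_image span_span)
    show "independent (T ` B)"
      using linear_independent_injective_image[OF assms(1) B(2)] assms(3) span by simp
  qed
  then show ?thesis
    using B assms(3) by (simp add: card_image inj_on_subset)
qed

text \<open>A basis of \<open>S\<close> extends to a basis of \<open>T\<close>, and the dimensions
  leave no room for new elements. The finite set \<open>F\<close> matters: the polynomial space is
  infinite-dimensional, and \<open>dim\<close> is 0 for a space with an infinite basis.\<close>

lemma subspace_eq_if_dim_ge:
  fixes S T :: "'a::real_vector set"
  assumes "subspace S" "subspace T" "S \<subseteq> T" "T \<subseteq> span F" "finite F" "dim T \<le> dim S"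
  shows "S = T"
proof -
  obtain B where B: "B \<subseteq> S" "independent B" "S \<subseteq> span B" "card B = dim S"
    using basis_exists by blast
  obtain C where C: "B \<subseteq> C" "C \<subseteq> T" "independent C" "T \<subseteq> span C"
    using maximal_independent_subset_extend[of B T] B assms(3) by (metis order.trans)
  have "finite C"
    using independent_span_bound[OF assms(5) C(3)] C(2) assms(4) by auto
  moreover have "card C = dim T" using C basis_card_eq_dim by blast
  ultimately have "B = C"
    using B(4) C(1) assms(6) card_seteq by metis
  then show ?thesis
    using B C assms(1,3) span_minimal by blast
qed

text \<open>Injectivity of \<open>poly_of_coeffs\<close> moves the dimension to the polynomial side,
  where the spaces for different \<open>l\<close> are nested.\<close>

lemma dim_Delta_ker:
  fixes f :: "('d::{finite,linorder} point \<Rightarrow> complex) \<Rightarrow> complex"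
  shows "dim (Delta_ker l f) = dim (hasse_core_le l (V_space f))"
proof -
  have "Delta_ker l f = {v. Poly_Mapping.keys v \<subseteq> {..<dbar CARD('d) l}} \<inter>
      poly_of_coeffs l -` hasse_core_le l (V_space f)"
    by (auto simp: Delta_ker_eq)
  then have "subspace (Delta_ker l f)"
    by (simp add: subspace_inter subspace_keys_subset linear_subspace_vimage
        linear_poly_of_coeffs subspace_hasse_core_le subspace_V_space)
  moreover have "inj_on (poly_of_coeffs l :: _ \<Rightarrow> 'd polynomial) (Delta_ker l f)"
    by (rule inj_on_subset[OF inj_on_poly_of_coeffs]) (auto simp: Delta_ker_eq)
  ultimately show ?thesis
    using dim_image_eq_inj_on[of "poly_of_coeffs l :: _ \<Rightarrow> 'd polynomial", OF linear_poly_of_coeffs]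
    by (metis poly_of_coeffs_Delta_ker)
qed

section \<open>The order of the Strang-Fix conditions and the stabilisation of the kernels\<close>

lemma V_tilde_eq_hasse_core_le:
  fixes f :: "('d::{finite,linorder} point \<Rightarrow> complex) \<Rightarrow> complex"
  shows "V_tilde f = hasse_core_le (strang_fix_order f) (V_space f)"
proof -
  have "V_tilde f = poly_of_coeffs (strang_fix_order f) ` Delta_ker (strang_fix_order f) f"
    unfolding V_tilde_def Let_def Setcompr_eq_image
  proof (rule image_cong)
    fix v assume "v \<in> Delta_ker (strang_fix_order f) f"
    then have "Poly_Mapping.keys v \<subseteq> {..<dbar CARD('d) (strang_fix_order f)}"
      by (simp add: Delta_ker_eq)
    then show "(\<Sum>k<dbar CARD('d) (strang_fix_order f). Poly_Mapping.single
        (mindex_list (strang_fix_order f) ! k) (Poly_Mapping.lookup v k)) = poly_of_coeffs (strang_fix_order f) v"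
      by (rule poly_of_coeffs_eq_sum[symmetric])
  qed simp
  then show ?thesis by (simp add: poly_of_coeffs_Delta_ker)
qed

lemma dim_Delta_ker_le_strang_fix_order:
  assumes "has_strang_fix_order f"
  shows "dim (Delta_ker m f) \<le> dim (Delta_ker (strang_fix_order f) f)"
proof -
  obtain l where l: "\<And>m. dim (Delta_ker m f) \<le> dim (Delta_ker l f)"
    using assms by (auto simp: has_strang_fix_order_def)
  \<comment> \<open>\<open>Max\<close> is meaningful on finite sets only; the attained bound
    \<open>l\<close> makes the set of dimensions finite.\<close>
  have fin: "finite (range (\<lambda>m. dim (Delta_ker m f)))"
    using l by (intro finite_subset[OF _ finite_atMost[of "dim (Delta_ker l f)"]]) auto
  then have "dim (Delta_ker l f) = Max (range (\<lambda>m. dim (Delta_ker m f)))"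
    using l by (intro Max_eqI[symmetric]) auto
  then have "dim (Delta_ker (strang_fix_order f) f) = Max (range (\<lambda>m. dim (Delta_ker m f)))"
    unfolding strang_fix_order_def by (rule LeastI)
  then show ?thesis using fin by simp
qed

theorem theorem2p3:
  fixes f :: "(real ^ 'd::{finite,linorder} \<Rightarrow> complex) \<Rightarrow> complex"
  assumes "tempered_distribution f"
    and "compact (distribution_support f)"
    and "has_strang_fix_order f"
  shows "V_tilde f = V_sh f"
proof -
  let ?V = "V_space f"
  define L where "L = strang_fix_order f"
  have "hasse_core ?V \<subseteq> hasse_core_le L ?V"
  proof
    fix P assume P: "P \<in> hasse_core ?V"
    obtain N where N: "Poly_Mapping.keys P \<subseteq> {\<alpha>. mlength \<alpha> \<le> N}"
      using keys_bounded_mlength[of P] .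
    \<comment> \<open>Large enough for the degree of \<open>P\<close>, and at least \<open>L\<close>
      so that the two spaces compared are nested.\<close>
    define m where "m = max L N"
    have "hasse_core_le L ?V = hasse_core_le m ?V"
    proof (rule subspace_eq_if_dim_ge)
      show "hasse_core_le L ?V \<subseteq> hasse_core_le m ?V"
        by (auto simp: hasse_core_le_def m_def)
      show "hasse_core_le m ?V \<subseteq> span ((\<lambda>\<alpha>. Poly_Mapping.single \<alpha> 1) ` {\<alpha>. mlength \<alpha> \<le> m})"
        using keys_subset_span[of "{\<alpha>. mlength \<alpha> \<le> m}"] by (auto simp: hasse_core_le_def)
      show "dim (hasse_core_le m ?V) \<le> dim (hasse_core_le L ?V)"
        using dim_Delta_ker_le_strang_fix_order[OF assms(3), of m] by (simp add: dim_Delta_ker L_def)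
    qed (simp_all add: subspace_hasse_core_le subspace_V_space finite_mlength_le)
    moreover have "P \<in> hasse_core_le m ?V"
      using P N by (fastforce simp: hasse_core_le_def m_def)
    ultimately show "P \<in> hasse_core_le L ?V" by simp
  qed
  then show ?thesis
    unfolding V_sh_eq_hasse_core V_tilde_eq_hasse_core_le L_def[symmetric]
    by (auto simp: hasse_core_le_def)
qed

end
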